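(* Let $N(\Lambda,\mathcal{T}^* )$ be the LVMB manifold associated to the LVMB datum $(\Lambda,\mathcal{T}^* )$, and let $Q\subseteq\mathbb{R}^d$ be the associated quasilattice. Then the rational dimension of $N(\Lambda,\mathcal{T}^* )$ is $d-\deg_{\mathrm{NR}}Q$, i.e. $a(\Lambda)=d-\deg_{\mathrm{NR}}Q$.
   Context: **Triangulated vector configurations.** A triangulated vector configuration in $\mathbb{R}^d$ is a pair $(V,\mathcal{T})$ where $V=(v_1,\dots,v_n)$ is a list of vectors (repetitions and zero vectors allowed) spanning $\mathbb{R}^d$, and $\mathcal{T}$ is an abstract simplicial complex of subsets of $\{1,\dots,n\}$ (with $\emptyset\in\mathcal{T}$) such that: for each $\tau\in\mathcal{T}$ the vectors $v_j$, $j\in\tau$, are linearly independent; $\mathrm{cone}(\tau)\cap\mathrm{cone}(\tau')=\mathrm{cone}(\tau\cap\tau')$ for all $\tau,\tau'\in\mathcal{T}$; and $\bigcup_{\tau\in\mathcal{T}}\mathrm{cone}(\tau)\supseteq \sum_{j=1}^n\mathbb{R}_{\ge0}v_j$. Here $\mathrm{cone}(\tau)=\sum_{j\in\tau}\mathbb{R}_{\ge0}v_j$. The configuration is *odd* if $n-d=2m+1$ for some integer $m>0$, and *balanced* if $\sum_i v_i=0$. Put $\mathrm{Rel}(V)=\{c\in\mathbb{R}^n:\sum_j c_jv_j=0\}$. **LVMB data.** Let $(V,\mathcal{T})$ be an odd and balanced triangulated vector configuration, $n-d=2m+1$. Choose a basis $(f_0,f_1,\dots,f_{2m})$ of $\mathrm{Rel}(V)$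 with $f_0=(1,\dots,1)$; the rows of the $n\times(2m+1)$ matrix with columns $f_0,\dots,f_{2m}$ have the form $(1,\Lambda_j^{\mathbb{R}})$ with $\Lambda_j^{\mathbb{R}}\in\mathbb{R}^{2m}$, $j=1,\dots,n$. Choose a period matrix, i.e. $\Pi\in\mathrm{Mat}_{m\times 2m}(\mathbb{C})$ whose $2m$ columns are $\mathbb{R}$-linearly independent, and set $\Lambda_j=\Lambda_j^{\mathbb{R}}\,{}^t\Pi\in\mathbb{C}^m$, $\Lambda=(\Lambda_1,\dots,\Lambda_n)$. Set $\mathcal{T}^*=\{\{1,\dots,n\}\setminus\tau:\tau\in\mathcal{T},\ |\tau|=d\}$. A pair $(\Lambda,\mathcal{T}^* )$ obtained in this way is called an LVMB datum; $(V,\mathcal{T})$ is recovered from it up to a linear automorphism of $\mathbb{R}^d$. **LVMB manifolds.** Let $U(\mathcal{T})=\bigcup_{\tau^*\in\mathcal{T}^*}\{z\in\mathbb{C}^n: z_j\neq0\ \forall j\in\tau^*\}$ and let $\mathbb{P}(U(\mathcal{T}))\subset\mathbb{CP}^{n-1}$ be its projectivization. The LVMB manifold $N(\Lambda,\mathcal{T}^* )$ is the orbit space of $\mathbb{P}(U(\mathcal{T}))$ under the $\mathbb{C}^m$-action $u\cdot(z_1:\dots:z_n)=(e^{2\pi i\langle\Lambda_1,u\rangle}z_1:\dots:e^{2\pi i\langle\Lambda_n,u\rangle}z_n)$, where $\langle\cdot,\cdot\rangle$ is the standard bilinear pairing on $\mathbb{C}^m$. **Rational dimension.** The rational dimension of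 $N(\Lambda,\mathcal{T}^* )$ is by definition $a(\Lambda)=\dim_{\mathbb{Q}}\{c\in\mathbb{Q}^n:\sum_j c_j\Lambda_j=0,\ \sum_j c_j=0\}$. **Quasilattices.** A quasilattice in $\mathbb{R}^d$ is the $\mathbb{Z}$-span of a finite set of $\mathbb{R}$-generators of $\mathbb{R}^d$. Its nonrationality degree is $\deg_{\mathrm{NR}}Q=\dim_{\mathbb{R}}(\overline Q)^0$, where $(\overline Q)^0$ is the connected component containing $0$ of the closure $\overline Q$ (a vector subspace of $\mathbb{R}^d$); $d-\deg_{\mathrm{NR}}Q$ is called the rationality degree of $Q$. The quasilattice associated to the LVMB datum $(\Lambda,\mathcal{T}^* )$ coming from $(V,\mathcal{T})$ is $Q=\mathrm{Span}_{\mathbb{Z}}(v_1,\dots,v_n)\subset\mathbb{R}^d$ (all vectors of $V$ included), which is unique up to linear automorphisms of $\mathbb{R}^d$. (The leaf space of the canonical foliation of $N(\Lambda,\mathcal{T}^* )$ is a toric quasifold with quasilattice $Q$, and its rationality degree is by definition that of $Q$.) *)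

theory Defs
  imports "HOL-Analysis.Analysis"
begin

text \<open>Linear independence of the family \<open>(v\<^sub>j)\<close> for \<open>j \<in> I\<close>, so that repeated vectors are dependent.\<close>

definition independent_family :: "('i \<Rightarrow> 'a::real_vector) \<Rightarrow> 'i set \<Rightarrow> bool" where
  "independent_family v I \<longleftrightarrow> inj_on v I \<and> independent (v ` I)"

definition basis_family :: "('i \<Rightarrow> 'a::real_vector) \<Rightarrow> 'a set \<Rightarrow> bool" where
  "basis_family f S \<longleftrightarrow> independent_family f UNIV \<and> span (range f) = S"

definition vcone :: "('n \<Rightarrow> 'e::real_vector) \<Rightarrow> 'n set \<Rightarrow> 'e set" where
  "vcone v \<tau> = {\<Sum>j\<in>\<tau>. c j *\<^sub>R v j | c. \<forall>j\<in>\<tau>. 0 \<le> c j}"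

definition simplicial_complex :: "'n set set \<Rightarrow> bool" where
  "simplicial_complex T \<longleftrightarrow> {} \<in> T \<and> (\<forall>\<tau>\<in>T. \<forall>\<sigma>. \<sigma> \<subseteq> \<tau> \<longrightarrow> \<sigma> \<in> T)"

text \<open>The space \<open>\<real>\<^sup>d\<close> is modelled by a linear subspace \<open>E\<close> of a Euclidean space, with \<open>d = dim E\<close>.
  Taking \<open>E = UNIV\<close> in \<open>real ^ 'd\<close> gives \<open>\<real>\<^sup>d\<close> itself for \<open>d \<ge> 1\<close>; the subspace \<open>E = {0}\<close> accounts
  for \<open>d = 0\<close>, which is not the dimension of any type of class \<open>euclidean_space\<close>.
  The list \<open>V = (v\<^sub>1, \<dots>, v\<^sub>n)\<close> is a family over a finite type \<open>'n\<close>, with \<open>n = CARD('n)\<close>.\<close>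

definition triangulated_configuration ::
    "'e::euclidean_space set \<Rightarrow> ('n::finite \<Rightarrow> 'e) \<Rightarrow> 'n set set \<Rightarrow> bool" where
  "triangulated_configuration E v T \<longleftrightarrow>
     span (range v) = E \<and>
     simplicial_complex T \<and>
     (\<forall>\<tau>\<in>T. independent_family v \<tau>) \<and>
     (\<forall>\<tau>\<in>T. \<forall>\<tau>'\<in>T. vcone v \<tau> \<inter> vcone v \<tau>' = vcone v (\<tau> \<inter> \<tau>')) \<and>
     vcone v UNIV \<subseteq> (\<Union>\<tau>\<in>T. vcone v \<tau>)"

definition balanced :: "('n::finite \<Rightarrow> 'e::real_vector) \<Rightarrow> bool" where
  "balanced v \<longleftrightarrow> (\<Sum>j\<in>UNIV. v j) = 0"

definition Rel :: "('n::finite \<Rightarrow> 'e::real_vector) \<Rightarrow> (real ^ 'n) set" where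
  "Rel v = {c. (\<Sum>j\<in>UNIV. c $ j *\<^sub>R v j) = 0}"

text \<open>The index type \<open>('m + 'm) option\<close> plays the role of \<open>{0, 1, \<dots>, 2m}\<close>, where \<open>m = CARD('m) > 0\<close>
  and \<open>None\<close> stands for the index \<open>0\<close>.\<close>

definition relation_basis ::
    "('n::finite \<Rightarrow> 'e::real_vector) \<Rightarrow> (('m::finite + 'm) option \<Rightarrow> real ^ 'n) \<Rightarrow> bool" where
  "relation_basis v f \<longleftrightarrow> basis_family f (Rel v) \<and> f None = (\<chi> j. 1)"

definition LambdaR :: "(('m::finite + 'm) option \<Rightarrow> real ^ 'n) \<Rightarrow> 'n::finite \<Rightarrow> real ^ ('m + 'm)" where
  "LambdaR f j = (\<chi> k. f (Some k) $ j)"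

definition period_matrix :: "complex ^ ('m::finite + 'm) ^ 'm \<Rightarrow> bool" where
  "period_matrix P \<longleftrightarrow> independent_family (\<lambda>k. column k P) UNIV"

definition lvmb_vectors ::
    "(('m::finite + 'm) option \<Rightarrow> real ^ 'n) \<Rightarrow> complex ^ ('m + 'm) ^ 'm \<Rightarrow>
     'n::finite \<Rightarrow> complex ^ 'm" where
  "lvmb_vectors f P j = (\<chi> k. complex_of_real (LambdaR f j $ k)) v* transpose P"

definition dual_facets :: "nat \<Rightarrow> 'n set set \<Rightarrow> 'n set set" where
  "dual_facets d T = {UNIV - \<tau> | \<tau>. \<tau> \<in> T \<and> card \<tau> = d}"

definition lvmb_datum_of ::
    "'e::euclidean_space set \<Rightarrow> ('n::finite \<Rightarrow> 'e) \<Rightarrow> 'n set set \<Rightarrow>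
     ('n \<Rightarrow> complex ^ 'm::finite) \<Rightarrow> 'n set set \<Rightarrow> bool" where
  "lvmb_datum_of E v T \<Lambda> Tst \<longleftrightarrow>
     triangulated_configuration E v T \<and>
     CARD('n) = dim E + (2 * CARD('m) + 1) \<and>
     balanced v \<and>
     (\<exists>(f :: ('m + 'm) option \<Rightarrow> real ^ 'n) (P :: complex ^ ('m + 'm) ^ 'm).
        relation_basis v f \<and> period_matrix P \<and> \<Lambda> = lvmb_vectors f P) \<and>
     Tst = dual_facets (dim E) T"

text \<open>The LVMB manifold as an orbit space. A point of projective space is represented by the set of
  its nonzero homogeneous coordinate vectors.\<close>

definition U_set :: "'n set set \<Rightarrow> (complex ^ 'n::finite) set" where
  "U_set Tst = (\<Union>\<sigma>\<in>Tst. {z. \<forall>j\<in>\<sigma>. z $ j \<noteq> 0})"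

definition proj_point :: "complex ^ 'n::finite \<Rightarrow> (complex ^ 'n) set" where
  "proj_point z = {c *s z | c. c \<noteq> 0}"

definition lvmb_action ::
    "('n \<Rightarrow> complex ^ 'm::finite) \<Rightarrow> complex ^ 'm \<Rightarrow> complex ^ 'n::finite \<Rightarrow> complex ^ 'n" where
  "lvmb_action \<Lambda> u z = (\<chi> j. exp (2 * of_real pi * \<i> * (\<Sum>a\<in>UNIV. \<Lambda> j $ a * u $ a)) * z $ j)"

definition lvmb_manifold ::
    "('n \<Rightarrow> complex ^ 'm::finite) \<Rightarrow> 'n set set \<Rightarrow> (complex ^ 'n::finite) set set set" where
  "lvmb_manifold \<Lambda> Tst = {{lvmb_action \<Lambda> u ` L | u. True} | L. L \<in> proj_point ` U_set Tst}"

text \<open>The rational dimension of the manifold \<open>lvmb_manifold \<Lambda> Tst\<close> is defined through the presentation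
  by \<open>\<Lambda>\<close>, not from the underlying orbit space. Here \<open>vec.dim\<close> is the dimension over the field of
  coefficients, i.e. over the rationals.\<close>

definition rational_dimension :: "('n::finite \<Rightarrow> complex ^ 'm::finite) \<Rightarrow> nat" where
  "rational_dimension \<Lambda> =
     vec.dim {c :: rat ^ 'n. (\<Sum>j\<in>UNIV. of_rat (c $ j) *s \<Lambda> j) = 0 \<and> (\<Sum>j\<in>UNIV. c $ j) = 0}"

definition quasilattice_of :: "('n::finite \<Rightarrow> 'e::real_vector) \<Rightarrow> 'e set" where
  "quasilattice_of v = {\<Sum>j\<in>UNIV. of_int (k j) *\<^sub>R v j | k :: 'n \<Rightarrow> int. True}"

definition nonrationality_degree :: "'e::euclidean_space set \<Rightarrow> nat" where
  "nonrationality_degree Q = dim (connected_component_set (closure Q) 0)"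

end

theory Submission
  imports Defs
begin

text \<open>Since the columns of the period matrix are real-independent, a rational vector \<open>c\<close> is
  counted by the rational dimension iff it is orthogonal to \<open>Rel v\<close>, that is, iff
  \<open>c\<^sub>j = \<phi> \<bullet> v\<^sub>j\<close> for some \<open>\<phi> \<in> E\<close>. So one counts the \<open>\<phi> \<in> E\<close> that are rational on all
  \<open>v\<^sub>j\<close>; rational independence of the vectors \<open>c\<close> implies real independence, so the real
  dimension of the span of these \<open>\<phi>\<close> is what matters.
  Let \<open>W\<close> be the union of the lines contained in the closure \<open>G\<close> of \<open>Q\<close>. The group \<open>G \<inter> W\<^sup>\<bottom>\<close> is
  discrete, hence \<open>W\<close> is the component of \<open>0\<close> in \<open>G\<close>. A rational \<open>\<phi>\<close> takes discrete values
  on \<open>G\<close>, so it vanishes on \<open>W\<close>. Conversely, a basis of \<open>E \<inter> W\<^sup>\<bottom>\<close> chosen among the projections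
  of the \<open>v\<^sub>j\<close> to \<open>W\<^sup>\<bottom>\<close> expresses all these projections rationally by discreteness, so its
  dual basis consists of rational \<open>\<phi>\<close>. Hence the rational \<open>\<phi>\<close> span \<open>E \<inter> W\<^sup>\<bottom>\<close>, of
  dimension \<open>dim E - dim W\<close>.\<close>

section \<open>Rational versus real dimension of sets of rational vectors\<close>

definition vec_of_rat :: "rat ^ 'n \<Rightarrow> real ^ 'n" where
  "vec_of_rat c = (\<chi> j. of_rat (c $ j))"

lemma inj_vec_of_rat: "inj vec_of_rat"
  by (auto simp: inj_def vec_of_rat_def vec_eq_iff)

text \<open>Over \<open>rat\<close> the nonzero \<open>r\<close> alone is independent in the reals,
  so the value 1 at \<open>r\<close> extends to a linear functional (a Hamel basis
  argument).\<close>

lemma exists_rat_functional: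
  fixes r :: real
  assumes "r \<noteq> 0"
  obtains h :: "real \<Rightarrow> rat"
  where "\<And>x y. h (x + y) = h x + h y" "\<And>q x. h (of_rat q * x) = q * h x" "h r = 1"
proof -
  let ?scale = "\<lambda>(q::rat) (x::real). of_rat q * x"
  interpret V: vector_space ?scale
    by unfold_locales (auto simp: algebra_simps of_rat_add of_rat_mult)
  interpret P: vector_space_pair ?scale "(*) :: rat \<Rightarrow> rat \<Rightarrow> rat" ..
  have "V.independent {r}"
    using assms by (subst V.independent_insert) (auto simp: V.independent_empty)
  then obtain h where "Vector_Spaces.linear ?scale (*) h" and hr: "\<forall>x\<in>{r}. h x = (1::rat)"
    using P.linear_independent_extend[of "{r}" "\<lambda>_. 1"] by blast
  then interpret h: Vector_Spaces.linear ?scale "(*)" h by simp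
  show thesis
    using that[of h] h.add h.scale hr by auto
qed

text \<open>A real dependency is turned into a rational one by a \<open>\<rat>\<close>-linear functional on \<open>\<real>\<close>
  that does not vanish at a chosen coefficient.\<close>

lemma independent_vec_of_rat:
  fixes B :: "(rat ^ 'n::finite) set"
  assumes "vec.independent B"
  shows "independent (vec_of_rat ` B)"
proof -
  have fin: "finite B"
    using assms vec.finiteI_independent by blast
  show ?thesis
  proof (rule independent_if_scalars_zero)
    show "finite (vec_of_rat ` B)" using fin by simp
  next
    fix f x
    assume sum0: "(\<Sum>x\<in>vec_of_rat ` B. f x *\<^sub>R x) = 0" and x: "x \<in> vec_of_rat ` B"
    then obtain b where b: "b \<in> B" "x = vec_of_rat b" by blast
    show "f x = 0"
    proof (rule ccontr)
      assume "f x \<noteq> 0"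
      then obtain h :: "real \<Rightarrow> rat" where add: "\<And>x y. h (x + y) = h x + h y"
        and scale: "\<And>q x. h (of_rat q * x) = q * h x" and h1: "h (f x) = 1"
        using exists_rat_functional by blast
      have h0: "h 0 = 0" using scale[of 0 0] by simp
      have hsum: "h (\<Sum>b\<in>S. g b) = (\<Sum>b\<in>S. h (g b))" for g :: "rat ^ 'n \<Rightarrow> real" and S
        by (induction S rule: infinite_finite_induct) (auto simp: add h0)
      have "(\<Sum>c\<in>B. f (vec_of_rat c) *\<^sub>R vec_of_rat c) = 0"
        using sum0 inj_vec_of_rat by (subst (asm) sum.reindex) (auto intro: inj_on_subset)
      then have 0: "(\<Sum>c\<in>B. of_rat (c $ j) * f (vec_of_rat c)) = 0" for j
        by (simp add: vec_eq_iff vec_of_rat_def mult.commute)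
      have "(\<Sum>c\<in>B. h (f (vec_of_rat c)) *s c) = 0"
        using arg_cong[OF 0, of h] by (simp add: vec_eq_iff hsum scale h0 mult.commute[of "h _"])
      then have "h (f (vec_of_rat b)) = 0"
        using assms fin b vec.independentD[of B B "\<lambda>c. h (f (vec_of_rat c))" b] by auto
      then show False using h1 b by simp
    qed
  qed
qed

text \<open>A rational basis of \<open>S\<close> stays independent over the reals, and its rational
  expansions are also real ones, so one basis computes both dimensions.\<close>

lemma dim_vec_of_rat_image:
  fixes S :: "(rat ^ 'n::finite) set"
  shows "dim (vec_of_rat ` S) = vec.dim S"
proof -
  obtain B where B: "B \<subseteq> S" "vec.independent B" "S \<subseteq> vec.span B" "card B = vec.dim S"
    using vec.basis_exists by blast
  have fin: "finite B"
    using B vec.finiteI_independent by blast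
  show ?thesis
  proof (rule dim_unique)
    show "vec_of_rat ` B \<subseteq> vec_of_rat ` S" using B by blast
    show "independent (vec_of_rat ` B)" by (rule independent_vec_of_rat) fact
    show "card (vec_of_rat ` B) = vec.dim S"
      using B(4) inj_vec_of_rat card_image inj_on_subset by (metis subset_UNIV)
    show "vec_of_rat ` S \<subseteq> span (vec_of_rat ` B)"
    proof
      fix x assume "x \<in> vec_of_rat ` S"
      then obtain c where c: "c \<in> S" "x = vec_of_rat c" by blast
      then obtain q where "c = (\<Sum>b\<in>B. q b *s b)"
        using B(3) vec.span_finite[OF fin] by fastforce
      then have x: "x = (\<Sum>b\<in>B. of_rat (q b) *\<^sub>R vec_of_rat b)"
        using c by (simp add: vec_eq_iff vec_of_rat_def of_rat_sum of_rat_mult)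
      show "x \<in> span (vec_of_rat ` B)"
        unfolding x by (intro span_sum span_scale span_base imageI)
    qed
  qed
qed

section \<open>Additive subgroups and their closures\<close>

definition add_subgroup :: "'a::ab_group_add set \<Rightarrow> bool" where
  "add_subgroup G \<longleftrightarrow> 0 \<in> G \<and> (\<forall>x\<in>G. \<forall>y\<in>G. x - y \<in> G)"

lemma add_subgroup_0: "add_subgroup G \<Longrightarrow> 0 \<in> G"
  and add_subgroup_diff: "add_subgroup G \<Longrightarrow> x \<in> G \<Longrightarrow> y \<in> G \<Longrightarrow> x - y \<in> G"
  by (auto simp: add_subgroup_def)

lemma add_subgroup_uminus: "add_subgroup G \<Longrightarrow> x \<in> G \<Longrightarrow> - x \<in> G"
  using add_subgroup_diff[of G 0 x] add_subgroup_0 by auto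

lemma add_subgroup_add: "add_subgroup G \<Longrightarrow> x \<in> G \<Longrightarrow> y \<in> G \<Longrightarrow> x + y \<in> G"
  using add_subgroup_diff[of G x "- y"] add_subgroup_uminus by auto

lemma add_subgroup_sum: "add_subgroup G \<Longrightarrow> (\<And>i. i \<in> I \<Longrightarrow> f i \<in> G) \<Longrightarrow> (\<Sum>i\<in>I. f i) \<in> G"
  by (induction I rule: infinite_finite_induct) (auto intro: add_subgroup_0 add_subgroup_add)

lemma add_subgroup_of_int:
  fixes x :: "'a::real_vector"
  assumes "add_subgroup G" "x \<in> G"
  shows "of_int k *\<^sub>R x \<in> G"
proof -
  have nat: "of_nat n *\<^sub>R x \<in> G" for n
    by (induction n) (simp_all add: scaleR_left_distrib assms add_subgroup_0 add_subgroup_add)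
  show ?thesis
  proof (cases k rule: int_cases2)
    case (nonneg n)
    then show ?thesis using nat[of n] by simp
  next
    case (nonpos n)
    then show ?thesis using add_subgroup_uminus[OF assms(1) nat[of n]] by simp
  qed
qed

lemma add_subgroup_closure:
  fixes G :: "'a::real_normed_vector set"
  assumes "add_subgroup G"
  shows "add_subgroup (closure G)"
  unfolding add_subgroup_def
proof (intro conjI ballI)
  show "0 \<in> closure G"
    using assms add_subgroup_0 closure_subset by blast
  fix x y assume "x \<in> closure G" "y \<in> closure G"
  then obtain a b where "\<forall>n. a n \<in> G" "a \<longlonglongrightarrow> x" "\<forall>n. b n \<in> G" "b \<longlonglongrightarrow> y"
    unfolding closure_sequential by blast
  then show "x - y \<in> closure G"
    unfolding closure_sequential using assms
    by (intro exI[of _ "\<lambda>n. a n - b n"]) (auto intro: add_subgroup_diff tendsto_diff)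
qed

section \<open>Closed subgroups: lines, identity component and discrete part\<close>

text \<open>For an additive subgroup \<open>G\<close> this is the largest linear subspace contained
  in \<open>G\<close>.\<close>

definition line_space :: "'a::real_vector set \<Rightarrow> 'a set" where
  "line_space G = {x. \<forall>t. t *\<^sub>R x \<in> G}"

lemma line_space_subset: "line_space G \<subseteq> G"
proof
  fix x assume "x \<in> line_space G"
  then have "1 *\<^sub>R x \<in> G" unfolding line_space_def by blast
  then show "x \<in> G" by simp
qed

lemma subspace_line_space: "add_subgroup G \<Longrightarrow> subspace (line_space G)"
  by (auto simp: subspace_def line_space_def scaleR_right_distrib intro: add_subgroup_0 add_subgroup_add)

text \<open>If \<open>x\<^sub>k \<in> G\<close> are nonzero and tend to \<open>0\<close>, then integer multiples of the \<open>x\<^sub>k\<close>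
  approximate every point of the line spanned by a limit point of \<open>x\<^sub>k / |x\<^sub>k|\<close>.\<close>

lemma closed_subgroup_without_lines_discrete:
  fixes G :: "'a::euclidean_space set"
  assumes "add_subgroup G" "closed G" "line_space G = {0}"
  obtains e where "e > 0" "\<And>x. x \<in> G \<Longrightarrow> norm x < e \<Longrightarrow> x = 0"
proof (rule ccontr)
  assume "\<not> thesis"
  then have "\<exists>x\<in>G. norm x < 1 / Suc k \<and> x \<noteq> 0" for k :: nat
    using that[of "1 / Suc k"] by auto
  then obtain x where x: "\<And>k. x k \<in> G" "\<And>k. norm (x k) < 1 / Suc k" "\<And>k::nat. x k \<noteq> 0"
    by metis
  define u where "u k = x k /\<^sub>R norm (x k)" for k
  have "\<forall>k. u k \<in> sphere 0 1"
    using x(3) by (simp add: u_def)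
  then obtain l r where l: "l \<in> sphere 0 1" and r: "strict_mono r" and ur: "(u \<circ> r) \<longlonglongrightarrow> l"
    using compact_sphere[of "0::'a" 1] unfolding compact_def by metis
  have x0: "(\<lambda>k. norm (x (r k))) \<longlonglongrightarrow> 0"
  proof -
    have "(\<lambda>k. norm (x k)) \<longlonglongrightarrow> 0"
      by (rule tendsto_sandwich[OF _ _ tendsto_const LIMSEQ_Suc[OF lim_1_over_n]])
        (use x(2) in \<open>auto intro!: always_eventually less_imp_le simp: field_simps\<close>)
    from LIMSEQ_subseq_LIMSEQ[OF this r] show ?thesis by (simp add: o_def)
  qed
  have "t *\<^sub>R l \<in> G" for t
  proof -
    \<comment> \<open>Rounding \<open>t / norm (x (r k))\<close> down costs at most one vector
      \<open>x (r k)\<close>, whose norm tends to 0.\<close>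
    define a where "a k = of_int \<lfloor>t / norm (x (r k))\<rfloor> *\<^sub>R x (r k)" for k
    have "norm (a k - t *\<^sub>R u (r k)) \<le> norm (x (r k))" for k
    proof -
      let ?n = "norm (x (r k))"
      have "a k - t *\<^sub>R u (r k) = (of_int \<lfloor>t / ?n\<rfloor> - t / ?n) *\<^sub>R x (r k)"
        by (simp add: a_def u_def algebra_simps divide_inverse)
      also have "norm \<dots> \<le> 1 * ?n"
        unfolding norm_scaleR by (intro mult_right_mono) (simp_all, linarith)
      finally show ?thesis by simp
    qed
    then have "(\<lambda>k. a k - t *\<^sub>R u (r k)) \<longlonglongrightarrow> 0"
      by (intro tendsto_norm_zero_cancel[OF tendsto_sandwich[OF _ _ tendsto_const x0]])
        (auto intro: always_eventually)
    moreover have "(\<lambda>k. t *\<^sub>R u (r k)) \<longlonglongrightarrow> t *\<^sub>R l"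
      using ur by (auto simp: o_def intro: tendsto_scaleR)
    ultimately have "a \<longlonglongrightarrow> t *\<^sub>R l"
      using tendsto_add by fastforce
    then show ?thesis
      by (rule closed_sequentially[OF assms(2), rotated])
        (simp add: a_def add_subgroup_of_int assms(1) x(1))
  qed
  then have "l = 0"
    using assms(3) by (auto simp: line_space_def)
  then show False using l by simp
qed

text \<open>Here \<open>p\<close> projects onto the complement of \<open>W\<close>, not onto
  \<open>W\<close>: it subtracts the expansion in an orthonormal basis of \<open>W\<close>.\<close>

lemma orthogonal_projection_exists:
  fixes W :: "'a::euclidean_space set"
  assumes "subspace W"
  obtains p where "linear p" "\<And>x. x - p x \<in> W" "\<And>x. p x \<in> W\<^sup>\<bottom>"
proof -
  obtain B where B: "B \<subseteq> W" "pairwise orthogonal B" "\<And>x. x \<in> B \<Longrightarrow> norm x = 1"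
      "independent B" "span B = W"
    using orthonormal_basis_subspace[OF assms] by metis
  have fin: "finite B"
    using B(4) independent_imp_finite by blast
  define p where "p x = x - (\<Sum>b\<in>B. (b \<bullet> x) *\<^sub>R b)" for x
  show thesis
  proof
    show "linear p"
      unfolding p_def
      by (intro linearI) (simp_all add: algebra_simps inner_add_right sum.distrib scaleR_sum_right)
    show "x - p x \<in> W" for x
      unfolding p_def B(5)[symmetric] by (simp add: span_sum span_scale span_base)
    show "p x \<in> W\<^sup>\<bottom>" for x
    proof -
      have "orthogonal (p x) b" if "b \<in> B" for b
      proof -
        have "(\<Sum>c\<in>B. (c \<bullet> x) * (c \<bullet> b)) = (\<Sum>c\<in>B. if c = b then b \<bullet> x else 0)"
          using B(2,3) that
          by (intro sum.cong refl) (auto simp: pairwise_def orthogonal_def norm_eq_1[symmetric])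
        then have "p x \<bullet> b = x \<bullet> b - b \<bullet> x"
          using that fin by (simp add: p_def inner_diff_left inner_sum_left)
        then show ?thesis
          by (simp add: orthogonal_def inner_commute)
      qed
      then have "orthogonal (p x) w" if "w \<in> W" for w
        using that B(5) orthogonal_to_span by metis
      then show ?thesis
        by (auto simp: orthogonal_comp_def orthogonal_commute)
    qed
  qed
qed

text \<open>A line in \<open>G\<close> orthogonal to \<open>line_space G\<close> would also lie in
  \<open>line_space G\<close>, so this closed subgroup contains no line.\<close>

lemma line_space_orthogonal_discrete:
  fixes G :: "'a::euclidean_space set"
  assumes "add_subgroup G" "closed G"
  obtains e where "e > 0" "\<And>x. x \<in> G \<inter> (line_space G)\<^sup>\<bottom> \<Longrightarrow> norm x < e \<Longrightarrow> x = 0"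
proof -
  let ?W = "line_space G"
  note sub = subspace_orthogonal_comp[of ?W]
  have "add_subgroup (G \<inter> ?W\<^sup>\<bottom>)"
    using assms(1) sub by (auto simp: add_subgroup_def subspace_0 subspace_diff)
  moreover have "closed (G \<inter> ?W\<^sup>\<bottom>)"
    using assms(2) sub by (simp add: closed_Int closed_subspace)
  moreover have "line_space (G \<inter> ?W\<^sup>\<bottom>) = {0}"
  proof -
    have "line_space (G \<inter> ?W\<^sup>\<bottom>) \<subseteq> ?W \<inter> ?W\<^sup>\<bottom>"
      using line_space_subset[of "G \<inter> ?W\<^sup>\<bottom>"] by (auto simp: line_space_def)
    also have "\<dots> = {0}"
      using subspace_line_space[OF assms(1)] by (rule orthogonal_Int_0)
    finally show ?thesis
      using subspace_0[OF subspace_line_space[OF \<open>add_subgroup (G \<inter> ?W\<^sup>\<bottom>)\<close>]] by blast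
  qed
  ultimately show thesis
    using closed_subgroup_without_lines_discrete that by blast
qed

text \<open>The line space is connected, being a subspace. Conversely, projecting the component
  along it gives a connected subset of a discrete group, hence a point.\<close>

lemma connected_component_closed_subgroup:
  fixes G :: "'a::euclidean_space set"
  assumes G: "add_subgroup G" "closed G"
  shows "connected_component_set G 0 = line_space G"
proof
  let ?W = "line_space G" and ?C = "connected_component_set G 0"
  note W = subspace_line_space[OF G(1)]
  show "?W \<subseteq> ?C"
    using W by (intro connected_component_maximal convex_connected subspace_imp_convex)
      (auto simp: subspace_0 line_space_subset)
  obtain e where e: "e > 0" "\<And>x. x \<in> G \<inter> ?W\<^sup>\<bottom> \<Longrightarrow> norm x < e \<Longrightarrow> x = 0"
    using line_space_orthogonal_discrete[OF G] by blast
  obtain p where p: "linear p" "\<And>x. x - p x \<in> ?W" "\<And>x. p x \<in> ?W\<^sup>\<bottom>"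
    using orthogonal_projection_exists[OF W] by blast
  \<comment> \<open>The removed part \<open>x - p x\<close> lies in \<open>?W\<close>, hence in
    \<open>G\<close>, so \<open>p\<close> does not leave \<open>G\<close>.\<close>
  have pG: "p x \<in> G \<inter> ?W\<^sup>\<bottom>" if "x \<in> G" for x
    using add_subgroup_diff[OF G(1) that, of "x - p x"] p(2,3) line_space_subset by fastforce
  let ?S = "p ` ?C"
  have C0: "0 \<in> ?C" using add_subgroup_0[OF G(1)] by simp
  have CG: "?C \<subseteq> G" by (rule connected_component_subset)
  have p0: "p 0 = 0" using p(1) linear_0 by blast
  have "connected ?S"
    using p(1) by (intro connected_continuous_image linear_continuous_on connected_connected_component)
      (simp add: linear_conv_bounded_linear)
  \<comment> \<open>Thus 0 is isolated in the image, which makes \<open>{0}\<close> both open and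
    closed there.\<close>
  moreover have "?S \<inter> ball 0 e = {0}"
  proof
    show "?S \<inter> ball 0 e \<subseteq> {0}" using e(2) pG CG by fastforce
    show "{0} \<subseteq> ?S \<inter> ball 0 e" using C0 p0 e(1) by force
  qed
  then have "openin (top_of_set ?S) {0}"
    by (metis open_ball openin_open_Int)
  moreover have "closedin (top_of_set ?S) {0}"
    using C0 p0 by (intro closedin_singleton[THEN iffD2]) force
  ultimately have "?S = {0}"
    unfolding connected_clopen by (metis insert_not_empty)
  then have "x - 0 \<in> ?W" if "x \<in> ?C" for x
    using p(2)[of x] that by (metis imageI singletonD)
  then show "?C \<subseteq> ?W" by auto
qed

text \<open>Reducing the multiples \<open>k w\<close> modulo the integral span of \<open>B\<close> gives elements of a bounded,
  hence finite, part of \<open>L\<close>; two of them coincide.\<close>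

lemma discrete_subgroup_representation_rational:
  fixes L :: "'a::euclidean_space set"
  assumes L: "add_subgroup L" and e: "e > 0" "\<And>x. x \<in> L \<Longrightarrow> norm x < e \<Longrightarrow> x = 0"
    and B: "B \<subseteq> L" "independent B" and w: "w \<in> L" "w \<in> span B"
  shows "representation B w b \<in> \<rat>"
proof (cases "b \<in> B")
  case False
  then have "representation B w b = 0"
    using representation_ne_zero by blast
  then show ?thesis by simp
next
  case b: True
  have fin: "finite B"
    using B(2) independent_imp_finite by blast
  let ?r = "representation B w"
  have w_eq: "w = (\<Sum>b\<in>B. ?r b *\<^sub>R b)"
    using sum_representation_eq[OF B(2) w(2) fin] by simp
  define f where "f k = of_nat k *\<^sub>R w - (\<Sum>b\<in>B. of_int \<lfloor>of_nat k * ?r b\<rfloor> *\<^sub>R b)" for k :: nat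
  let ?K = "L \<inter> cball 0 (\<Sum>b\<in>B. norm b)"
  have f_eq: "f k = (\<Sum>b\<in>B. (of_nat k * ?r b - of_int \<lfloor>of_nat k * ?r b\<rfloor>) *\<^sub>R b)" for k
    using arg_cong[OF w_eq, of "\<lambda>x. of_nat k *\<^sub>R x"]
    by (simp add: f_def scaleR_sum_right scaleR_left_diff_distrib sum_subtractf)
  have "f k \<in> ?K" for k
  proof
    show "f k \<in> L"
      unfolding f_def using L w B(1) add_subgroup_of_int[OF L w(1), of "int k"]
      by (intro add_subgroup_diff add_subgroup_sum add_subgroup_of_int) auto
    have "norm (f k) \<le> (\<Sum>b\<in>B. 1 * norm b)"
      unfolding f_eq
      by (intro sum_norm_le) (unfold norm_scaleR, intro mult_right_mono, simp_all, linarith)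
    then show "f k \<in> cball 0 (\<Sum>b\<in>B. norm b)" by simp
  qed
  \<comment> \<open>Points of \<open>L\<close> closer than \<open>e\<close> coincide, since their
    difference lies in \<open>L\<close>; a bounded uniformly discrete set is finite.\<close>
  moreover have "uniform_discrete ?K"
    unfolding uniform_discrete_def
    using e add_subgroup_diff[OF L] by (intro exI[of _ e]) (fastforce simp: dist_norm)
  then have "finite ?K"
    using uniform_discrete_finite_iff bounded_Int bounded_cball by blast
  ultimately have "finite (range f)"
    by (meson finite_subset image_subsetI)
  then have "\<not> inj f"
    using finite_imageD infinite_UNIV_nat by blast
  then obtain k k' where k: "k \<noteq> k'" "f k = f k'"
    unfolding inj_def by blast
  \<comment> \<open>\<open>g k b\<close> is the fractional part of \<open>k\<close> times the
    coordinate. Independence equates these parts for \<open>k\<close> and \<open>k'\<close>, so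
    \<open>k - k'\<close> times the coordinate is an integer.\<close>
  define g where "g k b = of_nat k * ?r b - of_int \<lfloor>of_nat k * ?r b\<rfloor>" for k b
  have "(\<Sum>b\<in>B. (g k b - g k' b) *\<^sub>R b) = 0"
    using k(2) unfolding f_eq g_def[symmetric] by (simp add: scaleR_left_diff_distrib sum_subtractf)
  then have "g k b - g k' b = 0"
    using independentD[OF B(2) fin subset_refl _ b, of "\<lambda>b. g k b - g k' b"] by blast
  then have "?r b = (of_int \<lfloor>of_nat k * ?r b\<rfloor> - of_int \<lfloor>of_nat k' * ?r b\<rfloor>) / (of_nat k - of_nat k')"
    using k(1) by (simp add: g_def field_simps)
  then show ?thesis
    by (metis Rats_diff Rats_divide Rats_of_int Rats_of_nat)
qed

section \<open>Covectors rational on the configuration\<close>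

text \<open>The coordinate functional extends to a linear \<open>g\<close> on the whole space,
  represented by \<open>adjoint g 1\<close>; projecting this vector to \<open>span B\<close> leaves
  its products with \<open>span B\<close> unchanged.\<close>

lemma dual_basis_vector:
  fixes B :: "'a::euclidean_space set"
  assumes "independent B"
  obtains \<phi> where "\<phi> \<in> span B" "\<And>x. x \<in> span B \<Longrightarrow> \<phi> \<bullet> x = representation B x b"
proof -
  obtain g :: "'a \<Rightarrow> real" where g: "linear g" "\<And>c. c \<in> B \<Longrightarrow> g c = representation B c b"
    using linear_independent_extend[OF assms, of "\<lambda>c. representation B c b"] by blast
  \<comment> \<open>The projection is taken along \<open>(span B)\<^sup>\<bottom>\<close>, so it
    lands in the double complement, which is \<open>span B\<close>.\<close>
  obtain p where p: "linear p" "\<And>x. x - p x \<in> (span B)\<^sup>\<bottom>" "\<And>x. p x \<in> (span B)\<^sup>\<bottom>\<^sup>\<bottom>"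
    using orthogonal_projection_exists[OF subspace_orthogonal_comp] by blast
  show thesis
  proof
    show "p (adjoint g 1) \<in> span B"
      using p(3) by (simp add: orthogonal_comp_self)
    fix x assume x: "x \<in> span B"
    have "g x = representation B x b"
    proof -
      have fin: "finite B"
        using assms independent_imp_finite by blast
      have "g x = g (\<Sum>c\<in>B. representation B x c *\<^sub>R c)"
        using sum_representation_eq[OF assms x fin] by simp
      also have "\<dots> = (\<Sum>c\<in>B. representation B x c * representation B c b)"
        using g by (simp add: linear_sum linear_scale)
      also have "\<dots> = (\<Sum>c\<in>B. if c = b then representation B x c else 0)"
        using assms by (intro sum.cong refl) (auto simp: representation_basis)
      \<comment> \<open>For \<open>b\<close> outside \<open>B\<close> both sides are 0, the default
        value of \<open>representation\<close>.\<close>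
      also have "\<dots> = representation B x b"
        using fin representation_ne_zero[of B x b] by auto
      finally show ?thesis .
    qed
    moreover have "adjoint g 1 \<bullet> x = g x"
      using adjoint_works[OF g(1), of x 1] by (simp add: inner_commute)
    moreover have "(adjoint g 1 - p (adjoint g 1)) \<bullet> x = 0"
      using p(2) x by (auto simp: orthogonal_comp_def orthogonal_def inner_commute)
    ultimately show "p (adjoint g 1) \<bullet> x = representation B x b"
      by (simp add: inner_diff_left)
  qed
qed

text \<open>Functionals on the span are encoded by the vectors representing them. This is a rational
  vector space, so \<open>dim\<close> below measures its real span.\<close>

definition rational_covectors :: "('n \<Rightarrow> 'e::euclidean_space) \<Rightarrow> 'e set" where
  "rational_covectors v = {\<phi> \<in> span (range v). \<forall>j. \<phi> \<bullet> v j \<in> \<rat>}"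

lemma add_subgroup_quasilattice_of:
  fixes v :: "'n::finite \<Rightarrow> 'e::real_vector"
  shows "add_subgroup (quasilattice_of v)"
  unfolding add_subgroup_def
proof (intro conjI ballI)
  show "0 \<in> quasilattice_of v"
    unfolding quasilattice_of_def by (force intro: exI[of _ "\<lambda>_. 0"])
  fix x y assume "x \<in> quasilattice_of v" "y \<in> quasilattice_of v"
  then obtain k l :: "'n \<Rightarrow> int" where "x = (\<Sum>j\<in>UNIV. of_int (k j) *\<^sub>R v j)"
    "y = (\<Sum>j\<in>UNIV. of_int (l j) *\<^sub>R v j)"
    unfolding quasilattice_of_def by blast
  then have "x - y = (\<Sum>j\<in>UNIV. of_int (k j - l j) *\<^sub>R v j)"
    by (simp add: scaleR_left_diff_distrib sum_subtractf)
  then show "x - y \<in> quasilattice_of v"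
    unfolding quasilattice_of_def by (intro CollectI exI[of _ "\<lambda>j. k j - l j"]) simp
qed

lemma mem_quasilattice_of: "v j \<in> quasilattice_of v"
proof -
  have "(\<Sum>i\<in>UNIV. of_int (if i = j then 1 else 0) *\<^sub>R v i) = (\<Sum>i\<in>UNIV. if i = j then v j else 0)"
    by (intro sum.cong) auto
  then show ?thesis
    unfolding quasilattice_of_def by (intro CollectI exI[of _ "\<lambda>i. if i = j then 1 else 0"]) simp
qed

lemma closure_quasilattice_of_subset:
  fixes v :: "'n::finite \<Rightarrow> 'e::euclidean_space"
  shows "closure (quasilattice_of v) \<subseteq> span (range v)"
proof (intro closure_minimal closed_subspace subspace_span subsetI)
  fix x assume "x \<in> quasilattice_of v"
  then obtain k :: "'n \<Rightarrow> int" where x: "x = (\<Sum>j\<in>UNIV. of_int (k j) *\<^sub>R v j)"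
    unfolding quasilattice_of_def by blast
  show "x \<in> span (range v)"
    unfolding x by (intro span_sum span_scale span_base rangeI)
qed

lemma rational_covectors_orthogonal:
  fixes v :: "'n::finite \<Rightarrow> 'e::euclidean_space"
  assumes \<phi>: "\<phi> \<in> rational_covectors v"
  shows "\<phi> \<in> (line_space (closure (quasilattice_of v)))\<^sup>\<bottom>"
proof -
  have "\<forall>j. \<exists>m::int. \<exists>n::nat. n > 0 \<and> \<phi> \<bullet> v j = of_int m / of_nat n"
  proof
    fix j
    have "\<phi> \<bullet> v j \<in> \<rat>" using \<phi> by (simp add: rational_covectors_def)
    then show "\<exists>m::int. \<exists>n::nat. n > 0 \<and> \<phi> \<bullet> v j = of_int m / of_nat n"
      unfolding Rats_eq_int_div_nat by auto
  qed
  then obtain m :: "'n \<Rightarrow> int" and n :: "'n \<Rightarrow> nat"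
    where n: "\<And>j. n j > 0" "\<And>j. \<phi> \<bullet> v j = of_int (m j) / of_nat (n j)"
    by metis
  \<comment> \<open>\<open>N\<close> is a common denominator: \<open>?f\<close> is integral on each
    \<open>v j\<close>, hence on the quasilattice, and hence on its closure because the integers are
    closed.\<close>
  define N where "N = (\<Prod>j\<in>UNIV. n j)"
  have N: "N > 0" using n(1) by (simp add: N_def prod_pos)
  let ?f = "\<lambda>x. of_nat N * (\<phi> \<bullet> x)"
  have int: "?f (v j) \<in> \<int>" for j
  proof -
    have "n j dvd N" unfolding N_def by (intro dvd_prodI) auto
    then obtain q where "N = n j * q" by blast
    then have "?f (v j) = of_nat q * of_int (m j)"
      using n[of j] by simp
    then show ?thesis by simp
  qed
  have "?f x \<in> \<int>" if x: "x \<in> quasilattice_of v" for x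
  proof -
    obtain k :: "'n \<Rightarrow> int" where "x = (\<Sum>j\<in>UNIV. of_int (k j) *\<^sub>R v j)"
      using x unfolding quasilattice_of_def by auto
    then have "?f x = (\<Sum>j\<in>UNIV. of_int (k j) * ?f (v j))"
      by (simp add: inner_sum_right sum_distrib_left mult.left_commute)
    then show ?thesis
      using int by (metis (no_types, lifting) Ints_mult Ints_of_int Ints_sum)
  qed
  then have "quasilattice_of v \<subseteq> ?f -` \<int>" by auto
  then have clos: "closure (quasilattice_of v) \<subseteq> ?f -` \<int>"
    by (intro closure_minimal) (auto intro!: closed_vimage continuous_intros)
  have "\<phi> \<bullet> w = 0" if w: "w \<in> line_space (closure (quasilattice_of v))" for w
  proof (rule ccontr)
    assume "\<phi> \<bullet> w \<noteq> 0"
    \<comment> \<open>The scalar is chosen to give the non-integral value 1/2 on the line through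
      \<open>w\<close>.\<close>
    then have "?f ((1 / (2 * of_nat N * (\<phi> \<bullet> w))) *\<^sub>R w) = 1 / 2"
      using N by simp
    moreover have "?f (t *\<^sub>R w) \<in> \<int>" for t
      using w clos unfolding line_space_def by blast
    ultimately have "1 / 2 \<in> (\<int> :: real set)" by metis
    then show False by simp
  qed
  then show ?thesis
    by (simp add: orthogonal_comp_def orthogonal_def inner_commute)
qed

lemma span_rational_covectors:
  fixes v :: "'n::finite \<Rightarrow> 'e::euclidean_space"
  shows "span (rational_covectors v) = span (range v) \<inter> (line_space (closure (quasilattice_of v)))\<^sup>\<bottom>"
    (is "_ = ?E \<inter> ?W\<^sup>\<bottom>")
proof
  show "span (rational_covectors v) \<subseteq> ?E \<inter> ?W\<^sup>\<bottom>"
    using rational_covectors_orthogonal[of _ v]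
    by (intro span_minimal subspace_inter subspace_span subspace_orthogonal_comp)
      (auto simp: rational_covectors_def)
next
  let ?G = "closure (quasilattice_of v)"
  have G: "add_subgroup ?G" "closed ?G"
    by (auto intro: add_subgroup_closure add_subgroup_quasilattice_of)
  let ?L = "?G \<inter> ?W\<^sup>\<bottom>"
  have L: "add_subgroup ?L"
    using G(1) subspace_orthogonal_comp[of ?W] by (auto simp: add_subgroup_def subspace_0 subspace_diff)
  obtain e where e: "e > 0" "\<And>x. x \<in> ?L \<Longrightarrow> norm x < e \<Longrightarrow> x = 0"
    using line_space_orthogonal_discrete[OF G] by blast
  obtain p where p: "linear p" "\<And>x. x - p x \<in> ?W" "\<And>x. p x \<in> ?W\<^sup>\<bottom>"
    using orthogonal_projection_exists[OF subspace_line_space[OF G(1)]] by blast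
  have pv: "p (v j) \<in> ?L" for j
    using add_subgroup_diff[OF G(1) _ subsetD[OF line_space_subset p(2)], of "v j" "v j"]
      p(3) mem_quasilattice_of[of v j] closure_subset by fastforce
  \<comment> \<open>Choosing \<open>B\<close> among the projected vectors keeps it inside the
    discrete group \<open>?L\<close>, where coordinates are rational.\<close>
  obtain B where B: "B \<subseteq> range (p \<circ> v)" "independent B" "range (p \<circ> v) \<subseteq> span B"
    using maximal_independent_subset by blast
  have BL: "B \<subseteq> ?L" using B(1) pv by auto
  have fin: "finite B"
    using B(2) independent_imp_finite by blast
  have BE: "span B \<subseteq> ?E \<inter> ?W\<^sup>\<bottom>"
    using BL closure_quasilattice_of_subset
    by (intro span_minimal subspace_inter subspace_span subspace_orthogonal_comp) blast
  \<comment> \<open>A vector of \<open>?E\<close> orthogonal to \<open>?W\<close> is fixed by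
    \<open>p\<close>, and \<open>p\<close> maps \<open>?E\<close> into the span of the projected
    \<open>v j\<close>.\<close>
  have EB: "?E \<inter> ?W\<^sup>\<bottom> \<subseteq> span B"
  proof
    fix x assume x: "x \<in> ?E \<inter> ?W\<^sup>\<bottom>"
    then have "x - p x \<in> ?W \<inter> ?W\<^sup>\<bottom>"
      using p(2,3) by (simp add: subspace_diff subspace_orthogonal_comp)
    then have "p x = x"
      using orthogonal_Int_0[OF subspace_line_space[OF G(1)]] by auto
    moreover have "p x \<in> span (range (p \<circ> v))"
      using x linear_span_image[OF p(1), of "range v"] by (auto simp: image_comp)
    ultimately show "x \<in> span B"
      using B(3) by (metis span_minimal subspace_span subsetD)
  qed
  obtain \<phi> where \<phi>: "\<And>b. \<phi> b \<in> span B" "\<And>b x. x \<in> span B \<Longrightarrow> \<phi> b \<bullet> x = representation B x b"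
  proof -
    have "\<forall>b. \<exists>\<phi>. \<phi> \<in> span B \<and> (\<forall>x\<in>span B. \<phi> \<bullet> x = representation B x b)"
      using dual_basis_vector[OF B(2)] by metis
    from choice[OF this] show thesis using that by blast
  qed
  have \<phi>_rat: "\<phi> b \<in> rational_covectors v" for b
  proof -
    have "\<phi> b \<bullet> v j \<in> \<rat>" for j
    proof -
      \<comment> \<open>As \<open>\<phi> b\<close> is orthogonal to \<open>?W\<close>, it cannot
        distinguish \<open>v j\<close> from its projection.\<close>
      have "\<phi> b \<bullet> (v j - p (v j)) = 0"
        using \<phi>(1) BE p(2) by (fastforce simp: orthogonal_comp_def orthogonal_def inner_commute)
      moreover have pvB: "p (v j) \<in> span B"
        using B(3) by auto
      ultimately have "\<phi> b \<bullet> v j = representation B (p (v j)) b"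
        using \<phi>(2)[of "p (v j)" b] by (simp add: inner_diff_right)
      then show ?thesis
        using discrete_subgroup_representation_rational[OF L e BL B(2) pv pvB] by simp
    qed
    then show ?thesis
      using \<phi>(1) BE by (auto simp: rational_covectors_def)
  qed
  show "?E \<inter> ?W\<^sup>\<bottom> \<subseteq> span (rational_covectors v)"
  proof
    fix y assume "y \<in> ?E \<inter> ?W\<^sup>\<bottom>"
    then have y: "y \<in> span B" using EB by blast
    \<comment> \<open>\<open>z\<close> is the error of the dual basis expansion of \<open>y\<close>;
      it lies in \<open>span B\<close> and is orthogonal to \<open>B\<close>, hence
      vanishes.\<close>
    define z where "z = y - (\<Sum>b\<in>B. (y \<bullet> b) *\<^sub>R \<phi> b)"
    have zB: "z \<in> span B"
      unfolding z_def using y \<phi>(1) by (intro span_diff span_sum span_scale)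
    have "z \<bullet> c = 0" if "c \<in> B" for c
    proof -
      have "(\<Sum>b\<in>B. (y \<bullet> b) * (\<phi> b \<bullet> c)) = (\<Sum>b\<in>B. if b = c then y \<bullet> c else 0)"
        using that B(2) by (intro sum.cong) (auto simp: \<phi>(2) span_base representation_basis)
      then show ?thesis
        using that fin by (simp add: z_def inner_diff_left inner_sum_left)
    qed
    then have "orthogonal z z"
      using zB orthogonal_to_span[of z B z] by (simp add: orthogonal_def)
    then have y_eq: "y = (\<Sum>b\<in>B. (y \<bullet> b) *\<^sub>R \<phi> b)"
      by (simp add: orthogonal_self z_def)
    show "y \<in> span (rational_covectors v)"
      by (subst y_eq) (intro span_sum span_scale span_base \<phi>_rat)
  qed
qed

text \<open>The two summands are the dimensions of complementary subspaces of the span: the line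
  space of the closure and its orthogonal complement.\<close>

lemma dim_rational_covectors:
  fixes v :: "'n::finite \<Rightarrow> 'e::euclidean_space"
  shows "dim (rational_covectors v) + nonrationality_degree (quasilattice_of v) = dim (span (range v))"
proof -
  let ?G = "closure (quasilattice_of v)" and ?E = "span (range v)"
  have G: "add_subgroup ?G" "closed ?G"
    by (auto intro: add_subgroup_closure add_subgroup_quasilattice_of)
  have "line_space ?G \<subseteq> ?E"
    using line_space_subset closure_quasilattice_of_subset by blast
  then have "dim {y \<in> ?E. \<forall>x\<in>line_space ?G. orthogonal x y} + dim (line_space ?G) = dim ?E"
    using G(1) by (intro dim_subspace_orthogonal_to_vectors subspace_line_space subspace_span)
  moreover have "{y \<in> ?E. \<forall>x\<in>line_space ?G. orthogonal x y} = span (rational_covectors v)"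
    unfolding span_rational_covectors by (auto simp: orthogonal_comp_def)
  ultimately show ?thesis
    unfolding nonrationality_degree_def connected_component_closed_subgroup[OF G] by simp
qed

section \<open>Relations of the configuration and the LVMB vectors\<close>

text \<open>\<open>Rel v\<close> is the kernel of the adjoint of the evaluation map
  \<open>?T\<close>, so it is the complement of the image; taking complements once more gives the
  claim.\<close>

lemma Rel_orthogonal_comp:
  fixes v :: "'n::finite \<Rightarrow> 'e::euclidean_space"
  shows "(Rel v)\<^sup>\<bottom> = (\<lambda>\<phi>. \<chi> j. \<phi> \<bullet> v j) ` span (range v)"
proof -
  let ?T = "\<lambda>\<phi>. (\<chi> j. \<phi> \<bullet> v j) :: real ^ 'n"
  have T: "linear ?T"
    by (intro linearI) (auto simp: vec_eq_iff inner_add_left)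
  have T_inner: "?T \<phi> \<bullet> c = \<phi> \<bullet> (\<Sum>j\<in>UNIV. c $ j *\<^sub>R v j)" for \<phi> c
    by (simp add: inner_vec_def inner_sum_right mult.commute)
  have "Rel v = (?T ` span (range v))\<^sup>\<bottom>"
  proof (intro equalityI subsetI)
    fix c assume "c \<in> Rel v"
    then show "c \<in> (?T ` span (range v))\<^sup>\<bottom>"
      by (auto simp: Rel_def orthogonal_comp_def orthogonal_def T_inner)
  next
    fix c assume c: "c \<in> (?T ` span (range v))\<^sup>\<bottom>"
    have "(\<Sum>j\<in>UNIV. c $ j *\<^sub>R v j) \<in> span (range v)"
      by (intro span_sum span_scale span_base rangeI)
    then have "(\<Sum>j\<in>UNIV. c $ j *\<^sub>R v j) \<bullet> (\<Sum>j\<in>UNIV. c $ j *\<^sub>R v j) = 0"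
      using c unfolding T_inner[symmetric] by (auto simp: orthogonal_comp_def orthogonal_def)
    then show "c \<in> Rel v" by (simp add: Rel_def)
  qed
  then show ?thesis
    using orthogonal_comp_self[OF linear_subspace_image[OF T subspace_span]] by metis
qed

lemma of_real_of_rat: "of_real (of_rat q) = (of_rat q :: 'a::real_field)"
  by (cases q) (simp add: of_rat_rat)

text \<open>The relation among the LVMB vectors is a combination of the columns of \<open>P\<close>
  with real coefficients \<open>f (Some k) \<bullet> vec_of_rat c\<close>, so all of these vanish.
  The coordinate sum is the product with \<open>f None\<close>, and \<open>f\<close> spans
  \<open>Rel v\<close>.\<close>

lemma lvmb_relation_iff:
  fixes f :: "('m::finite + 'm) option \<Rightarrow> real ^ 'n::finite" and c :: "rat ^ 'n"
  assumes f: "relation_basis v f" and P: "period_matrix P"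
  shows "(\<Sum>j\<in>UNIV. of_rat (c $ j) *s lvmb_vectors f P j) = 0 \<and> (\<Sum>j\<in>UNIV. c $ j) = 0
    \<longleftrightarrow> vec_of_rat c \<in> (Rel v)\<^sup>\<bottom>"
proof -
  let ?s = "\<lambda>k. f (Some k) \<bullet> vec_of_rat c"
  have "(\<Sum>j\<in>UNIV. of_rat (c $ j) *s lvmb_vectors f P j) = (\<Sum>k\<in>UNIV. ?s k *\<^sub>R column k P)"
  proof (subst vec_eq_iff, intro allI)
    fix i
    have "(\<Sum>j\<in>UNIV. of_rat (c $ j) *s lvmb_vectors f P j) $ i
        = (\<Sum>j\<in>UNIV. \<Sum>k\<in>UNIV. of_rat (c $ j) * (of_real (f (Some k) $ j) * P $ i $ k))"
      by (simp add: lvmb_vectors_def vector_matrix_mult_def transpose_def LambdaR_def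
          sum_distrib_left mult.commute[of "P $ i $ _"])
    also have "\<dots> = (\<Sum>k\<in>UNIV. \<Sum>j\<in>UNIV. of_rat (c $ j) * (of_real (f (Some k) $ j) * P $ i $ k))"
      by (rule sum.swap)
    also have "\<dots> = (\<Sum>k\<in>UNIV. ?s k *\<^sub>R column k P) $ i"
      by (simp add: column_def inner_vec_def vec_of_rat_def scaleR_conv_of_real[where 'a=complex]
          sum_distrib_left sum_distrib_right mult_ac of_real_of_rat)
    finally show "(\<Sum>j\<in>UNIV. of_rat (c $ j) *s lvmb_vectors f P j) $ i
        = (\<Sum>k\<in>UNIV. ?s k *\<^sub>R column k P) $ i" .
  qed
  moreover have "(\<Sum>k\<in>UNIV. ?s k *\<^sub>R column k P) = 0 \<longleftrightarrow> (\<forall>k. ?s k = 0)"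
  proof -
    have inj: "inj (\<lambda>k. column k P)" and ind: "independent (range (\<lambda>k. column k P))"
      using P by (auto simp: period_matrix_def independent_family_def)
    \<comment> \<open>Injectivity turns the sum over indices into one over the set of columns, where
      independence of a set applies.\<close>
    have "(\<Sum>k\<in>UNIV. ?s k *\<^sub>R column k P)
        = (\<Sum>x\<in>range (\<lambda>k. column k P). ?s (inv (\<lambda>k. column k P) x) *\<^sub>R x)"
      using inj by (subst sum.reindex) (auto simp: inv_f_f[OF inj])
    then have "\<forall>k. ?s k = 0" if "(\<Sum>k\<in>UNIV. ?s k *\<^sub>R column k P) = 0"
      using independentD[OF ind finite_imageI[OF finite] subset_refl _ rangeI,
          of "\<lambda>x. ?s (inv (\<lambda>k. column k P) x)"] that
      by (simp add: inv_f_f[OF inj])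
    then show ?thesis by auto
  qed
  moreover have "(\<Sum>j\<in>UNIV. c $ j) = 0 \<longleftrightarrow> f None \<bullet> vec_of_rat c = 0"
  proof -
    have "f None \<bullet> vec_of_rat c = of_rat (\<Sum>j\<in>UNIV. c $ j)"
      using f by (simp add: relation_basis_def inner_vec_def vec_of_rat_def of_rat_sum)
    then show ?thesis by simp
  qed
  moreover have "vec_of_rat c \<in> (Rel v)\<^sup>\<bottom> \<longleftrightarrow> (\<forall>i. f i \<bullet> vec_of_rat c = 0)"
  proof
    have Rel: "span (range f) = Rel v"
      using f by (simp add: relation_basis_def basis_family_def)
    show "\<forall>i. f i \<bullet> vec_of_rat c = 0" if "vec_of_rat c \<in> (Rel v)\<^sup>\<bottom>"
      using that unfolding Rel[symmetric]
      by (auto simp: orthogonal_comp_def orthogonal_def span_base)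
    show "vec_of_rat c \<in> (Rel v)\<^sup>\<bottom>" if "\<forall>i. f i \<bullet> vec_of_rat c = 0"
    proof -
      have "orthogonal (vec_of_rat c) a" if a: "a \<in> Rel v" for a
        using \<open>\<forall>i. f i \<bullet> vec_of_rat c = 0\<close> a unfolding Rel[symmetric]
        by (intro orthogonal_to_span[of a "range f"]) (auto simp: orthogonal_def inner_commute)
      then show ?thesis
        by (auto simp: orthogonal_comp_def orthogonal_commute)
    qed
  qed
  ultimately show ?thesis
    by (metis option.exhaust)
qed

text \<open>Evaluation on the \<open>v j\<close> is injective on the span and carries the rational
  covectors exactly onto the rational vectors orthogonal to \<open>Rel v\<close>.\<close>

lemma rational_dimension_eq:
  fixes v :: "'n::finite \<Rightarrow> 'e::euclidean_space" and f :: "('m::finite + 'm) option \<Rightarrow> real ^ 'n"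
  assumes "relation_basis v f" "period_matrix P"
  shows "rational_dimension (lvmb_vectors f P) = dim (rational_covectors v)"
proof -
  let ?T = "\<lambda>\<phi>. (\<chi> j. \<phi> \<bullet> v j) :: real ^ 'n"
  have T: "linear ?T"
    by (intro linearI) (auto simp: vec_eq_iff inner_add_left)
  have rat: "range vec_of_rat = {x :: real ^ 'n. \<forall>j. x $ j \<in> \<rat>}"
  proof (intro equalityI subsetI CollectI allI)
    fix x :: "real ^ 'n" assume "x \<in> {x. \<forall>j. x $ j \<in> \<rat>}"
    then have "\<forall>j. \<exists>q. x $ j = of_rat q" by (auto elim: Rats_cases)
    then obtain q where "\<And>j. x $ j = of_rat (q j)" by metis
    then have "x = vec_of_rat (\<chi> j. q j)" by (simp add: vec_eq_iff vec_of_rat_def)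
    then show "x \<in> range vec_of_rat" by blast
  qed (auto simp: vec_of_rat_def)
  have "vec_of_rat ` {c. vec_of_rat c \<in> (Rel v)\<^sup>\<bottom>} = range vec_of_rat \<inter> (Rel v)\<^sup>\<bottom>"
    by blast
  also have "\<dots> = ?T ` rational_covectors v"
    unfolding rat Rel_orthogonal_comp by (auto simp: rational_covectors_def)
  finally have "rational_dimension (lvmb_vectors f P) = dim (?T ` rational_covectors v)"
    unfolding rational_dimension_def lvmb_relation_iff[OF assms]
    by (simp add: dim_vec_of_rat_image[symmetric])
  also have "\<dots> = dim (rational_covectors v)"
  proof (rule dim_image_eq[OF T])
    have "span (rational_covectors v) \<subseteq> span (range v)"
      unfolding span_rational_covectors by simp
    moreover have "inj_on ?T (span (range v))"
    proof (subst linear_inj_on_iff_eq_0[OF T subspace_span], intro ballI impI)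
      fix \<phi> assume "\<phi> \<in> span (range v)" "?T \<phi> = 0"
      then have "orthogonal \<phi> \<phi>"
        by (intro orthogonal_to_span[of \<phi> "range v"]) (auto simp: vec_eq_iff orthogonal_def)
      then show "\<phi> = 0" by (simp add: orthogonal_self)
    qed
    ultimately show "inj_on ?T (span (rational_covectors v))"
      using inj_on_subset by blast
  qed
  finally show ?thesis .
qed

theorem theorem3:
  fixes E :: "'e::euclidean_space set"
    and v :: "'n::finite \<Rightarrow> 'e"
    and T :: "'n set set"
    and \<Lambda> :: "'n \<Rightarrow> complex ^ 'm::finite"
    and Tst :: "'n set set"
    and Q :: "'e set"
  assumes "lvmb_datum_of E v T \<Lambda> Tst"
    and "Q = quasilattice_of v"
  shows "int (rational_dimension \<Lambda>) = int (dim E) - int (nonrationality_degree Q)"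
proof -
  obtain f :: "('m + 'm) option \<Rightarrow> real ^ 'n" and P
    where "relation_basis v f" "period_matrix P" "\<Lambda> = lvmb_vectors f P"
    using assms(1) by (auto simp: lvmb_datum_of_def)
  then have "rational_dimension \<Lambda> = dim (rational_covectors v)"
    using rational_dimension_eq by blast
  moreover have "E = span (range v)"
    using assms(1) by (simp add: lvmb_datum_of_def triangulated_configuration_def)
  ultimately show ?thesis
    using dim_rational_covectors[of v] assms(2) by simp
qed

end
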